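(* Let $(H,\circ)$ be a left invertible LA-semihypergroup with pure left identity $e$, such that for every $a\in H$ there exists $a'\in H$ with $a'\circ a=\{e\}$. Then the following conditions are equivalent: (i) $H$ is intra-regular; (ii) $R\cap L=R\circ L$ for every right hyperideal $R$ and every left hyperideal $L$ of $H$.
   Context: A hyperoperation on a non-empty set $H$ is a map $\circ: H\times H\to \mathcal{P}(H)\setminus\{\emptyset\}$. For non-empty $A,B\subseteq H$, $A\circ B=\bigcup_{a\in A,\,b\in B}a\circ b$, and singletons are identified with their elements. $(H,\circ)$ is an LA-semihypergroup if $(x\circ y)\circ z=(z\circ y)\circ x$ for all $x,y,z\in H$. An element $e\in H$ is a pure left identity if $e\circ a=\{a\}$ for all $a\in H$. $H$ is left invertible if for every $a\in H$ there exists $x\in H$ with $e\in x\circ a$. A non-empty subset $I\subseteq H$ is a left (resp. right) hyperideal if $H\circ I\subseteq I$ (resp. $I\circ H\subseteq I$). Write $a^2=a\circ a$. $H$ is intra-regular if for every $a\in H$ there exist $x,y\in H$ with $a\in (x\circ a^2)\circ y$. *)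

theory Defs
  imports Main
begin

definition hyperoperation :: "'a set \<Rightarrow> ('a \<Rightarrow> 'a \<Rightarrow> 'a set) \<Rightarrow> bool" where
  "hyperoperation H f \<longleftrightarrow>
     H \<noteq> {} \<and> (\<forall>x\<in>H. \<forall>y\<in>H. f x y \<subseteq> H \<and> f x y \<noteq> {})"

text \<open>Extension of a hyperoperation to subsets; an element standing next to a set in a
  product is written below as a singleton.\<close>

definition set_hop :: "('a \<Rightarrow> 'a \<Rightarrow> 'a set) \<Rightarrow> 'a set \<Rightarrow> 'a set \<Rightarrow> 'a set" where
  "set_hop f A B = (\<Union>a\<in>A. \<Union>b\<in>B. f a b)"

definition la_semihypergroup :: "'a set \<Rightarrow> ('a \<Rightarrow> 'a \<Rightarrow> 'a set) \<Rightarrow> bool" where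
  "la_semihypergroup H f \<longleftrightarrow>
     hyperoperation H f \<and>
     (\<forall>x\<in>H. \<forall>y\<in>H. \<forall>z\<in>H. set_hop f (f x y) {z} = set_hop f (f z y) {x})"

definition pure_left_identity :: "'a set \<Rightarrow> ('a \<Rightarrow> 'a \<Rightarrow> 'a set) \<Rightarrow> 'a \<Rightarrow> bool" where
  "pure_left_identity H f e \<longleftrightarrow> e \<in> H \<and> (\<forall>a\<in>H. f e a = {a})"

definition left_invertible :: "'a set \<Rightarrow> ('a \<Rightarrow> 'a \<Rightarrow> 'a set) \<Rightarrow> 'a \<Rightarrow> bool" where
  "left_invertible H f e \<longleftrightarrow> (\<forall>a\<in>H. \<exists>x\<in>H. e \<in> f x a)"

definition left_hyperideal :: "'a set \<Rightarrow> ('a \<Rightarrow> 'a \<Rightarrow> 'a set) \<Rightarrow> 'a set \<Rightarrow> bool" where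
  "left_hyperideal H f I \<longleftrightarrow> I \<noteq> {} \<and> I \<subseteq> H \<and> set_hop f H I \<subseteq> I"

definition right_hyperideal :: "'a set \<Rightarrow> ('a \<Rightarrow> 'a \<Rightarrow> 'a set) \<Rightarrow> 'a set \<Rightarrow> bool" where
  "right_hyperideal H f I \<longleftrightarrow> I \<noteq> {} \<and> I \<subseteq> H \<and> set_hop f I H \<subseteq> I"

definition intra_regular :: "'a set \<Rightarrow> ('a \<Rightarrow> 'a \<Rightarrow> 'a set) \<Rightarrow> bool" where
  "intra_regular H f \<longleftrightarrow>
     (\<forall>a\<in>H. \<exists>x\<in>H. \<exists>y\<in>H. a \<in> set_hop f (set_hop f {x} (f a a)) {y})"

end

(* With a' a = {e} for every a, both conditions hold outright.  By the left invertive law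
   (e a^2) a' = (a a) a' = (a' a) a = {a}, so H is intra-regular.  Every left hyperideal contains
   e and each h lies in (e e) h = (h e) e, so it is all of H; a right hyperideal R is also left,
   because h r = (e h) r = (r h) e, hence it is all of H too.  Condition (ii) then reads
   H = H H, which e guarantees. *)
theory Submission
  imports Defs
begin

lemma set_hop_singleton [simp]: "set_hop f {a} {b} = f a b"
  by (simp add: set_hop_def)

lemma set_hop_mono: "A \<subseteq> A' \<Longrightarrow> B \<subseteq> B' \<Longrightarrow> set_hop f A B \<subseteq> set_hop f A' B'"
  by (auto simp: set_hop_def)

lemma set_hop_subset_carrier:
  assumes "la_semihypergroup H f" "A \<subseteq> H" "B \<subseteq> H"
  shows "set_hop f A B \<subseteq> H"
  using assms unfolding la_semihypergroup_def hyperoperation_def set_hop_def by blast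

lemma hop_subset_carrier:
  assumes "la_semihypergroup H f" "x \<in> H" "y \<in> H"
  shows "f x y \<subseteq> H"
  using assms unfolding la_semihypergroup_def hyperoperation_def by blast

lemma left_invertive:
  assumes "la_semihypergroup H f" "x \<in> H" "y \<in> H" "z \<in> H"
  shows "set_hop f (f x y) {z} = set_hop f (f z y) {x}"
  using assms unfolding la_semihypergroup_def by blast

text \<open>A left inverse of any member of \<open>L\<close> brings \<open>e\<close> into
  \<open>L\<close>. Since \<open>L\<close> absorbs only from the left, the left invertive law is
  then needed to write each element as a product ending in \<open>e\<close>.\<close>

lemma left_hyperideal_eq_carrier:
  assumes la: "la_semihypergroup H f" and e: "pure_left_identity H f e"
    and inv: "\<forall>a\<in>H. \<exists>a'\<in>H. f a' a = {e}"
    and L: "left_hyperideal H f L"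
  shows "L = H"
proof
  show "L \<subseteq> H"
    using L by (simp add: left_hyperideal_def)
  obtain a where a: "a \<in> L" "a \<in> H"
    using L by (auto simp: left_hyperideal_def)
  then obtain a' where "a' \<in> H" "f a' a = {e}"
    using inv by blast
  then have "e \<in> set_hop f H L"
    using a by (auto simp: set_hop_def)
  then have eL: "e \<in> L"
    using L by (auto simp: left_hyperideal_def)
  have eH: "e \<in> H" and id: "\<And>h. h \<in> H \<Longrightarrow> f e h = {h}"
    using e by (auto simp: pure_left_identity_def)
  show "H \<subseteq> L"
  proof
    fix h assume h: "h \<in> H"
    have "{h} = set_hop f (f e e) {h}"
      by (simp add: id eH h)
    also have "\<dots> = set_hop f (f h e) {e}"
      by (rule left_invertive[OF la eH eH h])
    \<comment> \<open>The left factor \<open>f h e\<close> need only lie in \<open>H\<close>; the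
      right factor \<open>e\<close> is in \<open>L\<close>.\<close>
    also have "\<dots> \<subseteq> set_hop f H L"
      using hop_subset_carrier[OF la h eH] eL by (intro set_hop_mono) auto
    also have "\<dots> \<subseteq> L"
      using L by (simp add: left_hyperideal_def)
    finally show "h \<in> L" by simp
  qed
qed

text \<open>Inserting \<open>e\<close> in front of \<open>h\<close> turns \<open>f h r\<close> into
  a triple product. Swapping its outer factors puts \<open>r\<close> leftmost, where two right
  multiplications keep it in \<open>R\<close>.\<close>

lemma right_hyperideal_imp_left:
  assumes la: "la_semihypergroup H f" and e: "pure_left_identity H f e"
    and R: "right_hyperideal H f R"
  shows "left_hyperideal H f R"
proof -
  have eH: "e \<in> H" and id: "\<And>h. h \<in> H \<Longrightarrow> f e h = {h}"
    using e by (auto simp: pure_left_identity_def)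
  have RH: "R \<subseteq> H" and RR: "set_hop f R H \<subseteq> R"
    using R by (auto simp: right_hyperideal_def)
  have "f h r \<subseteq> R" if h: "h \<in> H" and r: "r \<in> R" for h r
  proof -
    have rH: "r \<in> H" using r RH by blast
    have "f h r = set_hop f (f e h) {r}"
      by (simp add: id h)
    also have "\<dots> = set_hop f (f r h) {e}"
      by (rule left_invertive[OF la eH h rH])
    also have "\<dots> \<subseteq> set_hop f (set_hop f R H) H"
      using set_hop_mono[of "{r}" R "{h}" H f] r h eH by (intro set_hop_mono) auto
    \<comment> \<open>Right absorption is used twice: first for the inner product, then for the
      outer one.\<close>
    also have "\<dots> \<subseteq> R"
      using set_hop_mono[OF RR order_refl] RR by blast
    finally show ?thesis .
  qed
  then show ?thesis
    using R by (auto simp: left_hyperideal_def right_hyperideal_def set_hop_def)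
qed

lemma set_hop_carrier_carrier:
  assumes "la_semihypergroup H f" "pure_left_identity H f e"
  shows "set_hop f H H = H"
proof
  show "set_hop f H H \<subseteq> H"
    by (rule set_hop_subset_carrier[OF assms(1)]) simp_all
  \<comment> \<open>Each \<open>h\<close> lies in \<open>f e h\<close>.\<close>
  show "H \<subseteq> set_hop f H H"
    using assms(2) unfolding pure_left_identity_def set_hop_def by blast
qed

text \<open>The witnesses are \<open>e\<close> on the left and a left inverse of \<open>a\<close> on
  the right; the swap brings that inverse next to \<open>a\<close>, and they cancel to
  \<open>e\<close>.\<close>

lemma intra_regular_if_left_inverses:
  assumes la: "la_semihypergroup H f" and e: "pure_left_identity H f e"
    and inv: "\<forall>a\<in>H. \<exists>a'\<in>H. f a' a = {e}"
  shows "intra_regular H f"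
  unfolding intra_regular_def
proof
  fix a assume a: "a \<in> H"
  obtain a' where a': "a' \<in> H" "f a' a = {e}"
    using inv a by blast
  have eH: "e \<in> H" and id: "\<And>h. h \<in> H \<Longrightarrow> f e h = {h}"
    using e by (auto simp: pure_left_identity_def)
  have "set_hop f {e} (f a a) = f a a"
    using hop_subset_carrier[OF la a a] id by (fastforce simp: set_hop_def)
  then have "set_hop f (set_hop f {e} (f a a)) {a'} = {a}"
    using left_invertive[OF la a a a'(1)] a'(2) id[OF a] by simp
  then show "\<exists>x\<in>H. \<exists>y\<in>H. a \<in> set_hop f (set_hop f {x} (f a a)) {y}"
    using eH a'(1) by blast
qed

theorem theorem7:
  fixes H :: "'a set" and hop :: "'a \<Rightarrow> 'a \<Rightarrow> 'a set" and e :: 'a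
  assumes "la_semihypergroup H hop"
    and "pure_left_identity H hop e"
    and "left_invertible H hop e"
    and "\<forall>a\<in>H. \<exists>a'\<in>H. hop a' a = {e}"
  shows "intra_regular H hop \<longleftrightarrow>
    (\<forall>R L. right_hyperideal H hop R \<and> left_hyperideal H hop L \<longrightarrow>
       R \<inter> L = set_hop hop R L)"
proof -
  \<comment> \<open>Both sides of the equivalence are proved outright, so neither direction is an
    actual deduction from the other.\<close>
  have "R \<inter> L = set_hop hop R L"
    if R: "right_hyperideal H hop R" and L: "left_hyperideal H hop L" for R L
  proof -
    have "R = H" "L = H"
      using left_hyperideal_eq_carrier[OF assms(1,2,4)]
        right_hyperideal_imp_left[OF assms(1,2) R] L by blast+
    then show ?thesis
      using set_hop_carrier_carrier[OF assms(1,2)] by simp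
  qed
  then show ?thesis
    using intra_regular_if_left_inverses[OF assms(1,2,4)] by blast
qed

end
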